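(* Let $H(x,\lambda^+)$ be the Hamiltonian (with the optimal control substituted) described in the context, and assume it is twice continuously differentiable. Let $(x,\lambda^+)$ be a point, and let $(\delta x,\delta\lambda,\delta x^+,\delta\lambda^+)$ and $(\widetilde{\delta x},\widetilde{\delta\lambda},\widetilde{\delta x}^+,\widetilde{\delta\lambda}^+)$ be two solutions of the tangent dynamics $$\begin{bmatrix}\delta x^+\\ \delta\lambda\end{bmatrix}=\begin{bmatrix} H_{\lambda^+x} & H_{\lambda^+\lambda^+}\\ H_{xx} & H_{\lambda^+x}'\end{bmatrix}\begin{bmatrix}\delta x\\ \delta\lambda^+\end{bmatrix},$$ with second partial derivatives evaluated at $(x,\lambda^+)$. Put $$v=\begin{bmatrix}\delta x\\ \delta\lambda\end{bmatrix},\quad w=\begin{bmatrix}\widetilde{\delta x}\\ \widetilde{\delta\lambda}\end{bmatrix},\quad v^+=\begin{bmatrix}\delta x^+\\ \delta\lambda^+\end{bmatrix},\quad w^+=\begin{bmatrix}\widetilde{\delta x}^+\\ \widetilde{\delta\lambda}^+\end{bmatrix}.$$ Then the symplectic two-form $\Omega$ is preserved: $\Omega(v,w)=\Omega(v^+,w^+)$.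
   Context: A prime denotes transpose; all tangent vectors $\delta x,\delta\lambda$, etc. lie in $\mathbb{R}^n$. The symplectic two-form on $\mathbb{R}^{2n}$ is $$\Omega(v,w)=v'Jw,\qquad J=\begin{bmatrix}0&I\\-I&0\end{bmatrix}.$$ The Hamiltonian comes from a discrete-time optimal control problem with dynamics $x^+=f(x,u)$ and running cost $l(x,u)$, $x\in\mathbb{R}^n$, $u\in\mathbb{R}^m$: $H(x,u,\lambda^+)=(\lambda^+)'f(x,u)+l(x,u)$, with $u=u^*(x,\lambda^+)$ the minimizer of $H$ in $u$; substituting it gives $H(x,\lambda^+)=H(x,u^*(x,\lambda^+),\lambda^+)$. The bidirectional nonlinear Hamiltonian dynamics are $x^+=\frac{\partial H}{\partial\lambda^+}(x,\lambda^+)$, $\lambda=\frac{\partial H}{\partial x}(x,\lambda^+)$, and the tangent dynamics are their linearization. $H_{xx}$ and $H_{\lambda^+\lambda^+}$ are the ($n\times n$) Hessian blocks and $H_{\lambda^+x}$ is the matrix with $(i,j)$ entry $\frac{\partial^2H}{\partial\lambda^+_i\partial x_j}$. *)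

theory Defs
  imports "HOL-Analysis.Analysis"
begin

text \<open>\<open>\<real>\<^sup>2\<^sup>n\<close> is rendered as \<open>real ^ ('n + 'n)\<close>; the \<open>Inl\<close> coordinates form the upper block.\<close>

definition stack :: "real ^ 'a \<Rightarrow> real ^ 'b \<Rightarrow> real ^ ('a::finite + 'b::finite)" where
  "stack a b = (\<chi> k. case k of Inl i \<Rightarrow> a $ i | Inr i \<Rightarrow> b $ i)"

text \<open>\<open>block_mat A B C D\<close> has rows \<open>[A B]\<close> and \<open>[C D]\<close>.\<close>

definition block_mat ::
  "real ^ 'a ^ 'c \<Rightarrow> real ^ 'b ^ 'c \<Rightarrow> real ^ 'a ^ 'd \<Rightarrow> real ^ 'b ^ 'd
    \<Rightarrow> real ^ ('a::finite + 'b::finite) ^ ('c::finite + 'd::finite)" where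
  "block_mat A B C D =
     (\<chi> k m. case k of
         Inl i \<Rightarrow> (case m of Inl j \<Rightarrow> A $ i $ j | Inr j \<Rightarrow> B $ i $ j)
       | Inr i \<Rightarrow> (case m of Inl j \<Rightarrow> C $ i $ j | Inr j \<Rightarrow> D $ i $ j))"

definition symplectic_J :: "real ^ ('n::finite + 'n) ^ ('n + 'n)" where
  "symplectic_J = block_mat 0 (mat 1) (- mat 1) 0"

definition symplectic_form :: "real ^ ('n::finite + 'n) \<Rightarrow> real ^ ('n + 'n) \<Rightarrow> real" where
  "symplectic_form v w = v \<bullet> (symplectic_J *v w)"

definition twice_continuously_differentiable :: "('a::real_normed_vector \<Rightarrow> real) \<Rightarrow> bool" where
  "twice_continuously_differentiable g \<longleftrightarrow>
     (\<exists>(D :: 'a \<Rightarrow> 'a \<Rightarrow>\<^sub>L real) (D2 :: 'a \<Rightarrow> 'a \<Rightarrow>\<^sub>L 'a \<Rightarrow>\<^sub>L real).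
        (\<forall>z. (g has_derivative blinfun_apply (D z)) (at z)) \<and>
        (\<forall>z. (D has_derivative blinfun_apply (D2 z)) (at z)) \<and>
        continuous_on UNIV D2)"

definition partial_deriv :: "'n \<Rightarrow> (real ^ 'n \<Rightarrow> real) \<Rightarrow> real ^ 'n::finite \<Rightarrow> real" where
  "partial_deriv j g x = deriv (\<lambda>t. g (x + t *\<^sub>R axis j 1)) 0"

text \<open>
  Hessian blocks of \<open>H x p\<close>, where \<open>p\<close> stands for the costate \<open>\<lambda>\<^sup>+\<close>. In \<open>\<partial>\<^sup>2H/\<partial>a\<^sub>i\<partial>b\<^sub>j\<close> the derivative
  with respect to \<open>b\<^sub>j\<close> is taken first.
\<close>

definition hess_xx :: "(real ^ 'n \<Rightarrow> real ^ 'n \<Rightarrow> real) \<Rightarrow> real ^ 'n \<Rightarrow> real ^ 'n \<Rightarrow> real ^ 'n ^ 'n::finite" where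
  "hess_xx H x p =
     (\<chi> i j. partial_deriv i (\<lambda>y. partial_deriv j (\<lambda>z. H z p) y) x)"

definition hess_px :: "(real ^ 'n \<Rightarrow> real ^ 'n \<Rightarrow> real) \<Rightarrow> real ^ 'n \<Rightarrow> real ^ 'n \<Rightarrow> real ^ 'n ^ 'n::finite" where
  "hess_px H x p =
     (\<chi> i j. partial_deriv i (\<lambda>q. partial_deriv j (\<lambda>z. H z q) x) p)"

definition hess_pp :: "(real ^ 'n \<Rightarrow> real ^ 'n \<Rightarrow> real) \<Rightarrow> real ^ 'n \<Rightarrow> real ^ 'n \<Rightarrow> real ^ 'n ^ 'n::finite" where
  "hess_pp H x p =
     (\<chi> i j. partial_deriv i (\<lambda>q. partial_deriv j (\<lambda>r. H x r) q) p)"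

definition control_hamiltonian ::
  "(real ^ 'n \<Rightarrow> real ^ 'm \<Rightarrow> real ^ 'n) \<Rightarrow> (real ^ 'n \<Rightarrow> real ^ 'm \<Rightarrow> real)
    \<Rightarrow> real ^ 'n::finite \<Rightarrow> real ^ 'm::finite \<Rightarrow> real ^ 'n \<Rightarrow> real" where
  "control_hamiltonian f l x u p = p \<bullet> f x u + l x u"

definition optimal_control ::
  "(real ^ 'n \<Rightarrow> real ^ 'm \<Rightarrow> real ^ 'n) \<Rightarrow> (real ^ 'n \<Rightarrow> real ^ 'm \<Rightarrow> real)
    \<Rightarrow> (real ^ 'n::finite \<Rightarrow> real ^ 'n \<Rightarrow> real ^ 'm::finite) \<Rightarrow> bool" where
  "optimal_control f l ustar \<longleftrightarrow>
     (\<forall>x p. is_arg_min (\<lambda>u. control_hamiltonian f l x u p) (\<lambda>u. True) (ustar x p))"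

definition optimal_hamiltonian ::
  "(real ^ 'n \<Rightarrow> real ^ 'm \<Rightarrow> real ^ 'n) \<Rightarrow> (real ^ 'n \<Rightarrow> real ^ 'm \<Rightarrow> real)
    \<Rightarrow> (real ^ 'n \<Rightarrow> real ^ 'n \<Rightarrow> real ^ 'm)
    \<Rightarrow> real ^ 'n::finite \<Rightarrow> real ^ 'n \<Rightarrow> real" where
  "optimal_hamiltonian f l ustar x p =
     control_hamiltonian f l x (ustar x p :: real ^ 'm::finite) p"

text \<open>
  The arguments \<open>dx dl dx' dl'\<close> are \<open>\<delta>x, \<delta>\<lambda>, \<delta>x\<^sup>+, \<delta>\<lambda>\<^sup>+\<close>.
\<close>

definition tangent_solution ::
  "(real ^ 'n \<Rightarrow> real ^ 'n \<Rightarrow> real) \<Rightarrow> real ^ 'n \<Rightarrow> real ^ 'n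
    \<Rightarrow> real ^ 'n::finite \<Rightarrow> real ^ 'n \<Rightarrow> real ^ 'n \<Rightarrow> real ^ 'n \<Rightarrow> bool" where
  "tangent_solution H x p dx dl dx' dl' \<longleftrightarrow>
     stack dx' dl =
       block_mat (hess_px H x p) (hess_pp H x p)
                 (hess_xx H x p) (transpose (hess_px H x p)) *v stack dx dl'"

end

theory Submission
  imports Defs
begin

text \<open>
  Write \<open>A = H\<^sub>p\<^sub>x\<close>, \<open>B = H\<^sub>p\<^sub>p\<close>, \<open>C = H\<^sub>x\<^sub>x\<close>, and let \<open>e\<close> mark the second solution. On stacked
  vectors the symplectic form is \<open>\<Omega> = dx \<bullet> el - dl \<bullet> ex\<close>. Substituting \<open>\<delta>\<lambda> = C \<delta>x + A' \<delta>\<lambda>\<^sup>+\<close> at the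
  earlier time gives
    \<open>\<Omega>(v, w) = A dx \<bullet> el' - dl' \<bullet> A ex + (dx \<bullet> C ex - C dx \<bullet> ex)\<close>,
  and substituting \<open>\<delta>x\<^sup>+ = A \<delta>x + B \<delta>\<lambda>\<^sup>+\<close> at the later time gives
    \<open>\<Omega>(v\<^sup>+, w\<^sup>+) = A dx \<bullet> el' - dl' \<bullet> A ex + (B dl' \<bullet> el' - dl' \<bullet> B el')\<close>.
  Because \<open>A\<close> and its transpose are the off-diagonal coefficients, the two agree as soon as \<open>B\<close> and
  \<open>C\<close> are symmetric.

  Symmetry of the Hessian blocks is the analytic content, and it is the symmetry of the second
  derivative of a \<open>C\<^sup>2\<close> function (\<open>second_derivative_symmetric\<close>): the second difference over a small
  parallelogram does not depend on the order of its sides, and applying the mean value theorem in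
  either order expresses it through the second derivative at a nearby point
  (\<open>second_difference_mean_value\<close>).
\<close>

section \<open>Symmetry of the second derivative\<close>

text \<open>
  The mean value theorem is applied first along \<open>u\<close> to the increment in direction \<open>v\<close>, then along
  \<open>v\<close> to the directional derivative \<open>D \<cdot> u\<close>. The intermediate point depends on this order, so the lemma
  alone does not yield symmetry.
\<close>

lemma second_difference_mean_value:
  fixes g :: "'a::real_normed_vector \<Rightarrow> real"
    and D :: "'a \<Rightarrow> 'a \<Rightarrow>\<^sub>L real" and D2 :: "'a \<Rightarrow> 'a \<Rightarrow>\<^sub>L 'a \<Rightarrow>\<^sub>L real"
  assumes D: "\<And>z. (g has_derivative blinfun_apply (D z)) (at z)"
    and D2: "\<And>z. (D has_derivative blinfun_apply (D2 z)) (at z)"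
    and "0 < t"
  obtains s r where "0 < s" "s < t" "0 < r" "r < t"
    "g (z + t *\<^sub>R u + t *\<^sub>R v) - g (z + t *\<^sub>R u) - g (z + t *\<^sub>R v) + g z
       = t\<^sup>2 * D2 (z + s *\<^sub>R u + r *\<^sub>R v) v u"
proof -
  define \<phi> where "\<phi> = (\<lambda>s. g (z + s *\<^sub>R u + t *\<^sub>R v) - g (z + s *\<^sub>R u))"
  have "(\<phi> has_real_derivative D (z + s *\<^sub>R u + t *\<^sub>R v) u - D (z + s *\<^sub>R u) u) (at s)" for s
    unfolding \<phi>_def has_field_derivative_def
    by (rule derivative_eq_intros has_derivative_compose[OF _ D] refl)+
       (auto simp: blinfun.bilinear_simps algebra_simps)
  from MVT2[OF \<open>0 < t\<close> this] obtain s where s: "0 < s" "s < t"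
    "\<phi> t - \<phi> 0 = t * (D (z + s *\<^sub>R u + t *\<^sub>R v) u - D (z + s *\<^sub>R u) u)"
    by auto
  define \<psi> where "\<psi> = (\<lambda>r. D (z + s *\<^sub>R u + r *\<^sub>R v) u)"
  have "(\<psi> has_real_derivative D2 (z + s *\<^sub>R u + r *\<^sub>R v) v u) (at r)" for r
    unfolding \<psi>_def has_field_derivative_def
    by (rule derivative_eq_intros has_derivative_compose[OF _ D2] refl)+
       (auto simp: blinfun.bilinear_simps algebra_simps)
  from MVT2[OF \<open>0 < t\<close> this] obtain r where r: "0 < r" "r < t"
    "\<psi> t - \<psi> 0 = t * D2 (z + s *\<^sub>R u + r *\<^sub>R v) v u"
    by auto
  have "g (z + t *\<^sub>R u + t *\<^sub>R v) - g (z + t *\<^sub>R u) - g (z + t *\<^sub>R v) + g z = \<phi> t - \<phi> 0"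
    by (simp add: \<phi>_def)
  also have "\<dots> = t * (\<psi> t - \<psi> 0)"
    by (simp add: s(3) \<psi>_def)
  also have "\<dots> = t\<^sup>2 * D2 (z + s *\<^sub>R u + r *\<^sub>R v) v u"
    by (simp add: r(3) power2_eq_square)
  finally show ?thesis
    using that s(1,2) r(1,2) by blast
qed

text \<open>
  Computing the same second difference in both orders makes \<open>D2 \<cdot> v u\<close> at one intermediate point
  equal to \<open>D2 \<cdot> u v\<close> at another. As the parallelogram shrinks, both points tend to \<open>z\<close>, and
  continuity of \<open>D2\<close> transfers the equality to \<open>z\<close>.
\<close>

lemma second_derivative_symmetric:
  fixes g :: "'a::real_normed_vector \<Rightarrow> real"
    and D :: "'a \<Rightarrow> 'a \<Rightarrow>\<^sub>L real" and D2 :: "'a \<Rightarrow> 'a \<Rightarrow>\<^sub>L 'a \<Rightarrow>\<^sub>L real"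
  assumes D: "\<And>z. (g has_derivative blinfun_apply (D z)) (at z)"
    and D2: "\<And>z. (D has_derivative blinfun_apply (D2 z)) (at z)"
    and cont: "continuous_on UNIV D2"
  shows "D2 z u v = D2 z v u"
proof -
  define t where "t n = inverse (real (Suc n))" for n
  have t_pos: "0 < t n" for n
    by (simp add: t_def)
  have t_lim: "t \<longlonglongrightarrow> 0"
    unfolding t_def by (rule LIMSEQ_inverse_real_of_nat)
  have "\<exists>s r s' r'. 0 < s \<and> s < t n \<and> 0 < r \<and> r < t n \<and> 0 < s' \<and> s' < t n \<and> 0 < r' \<and> r' < t n \<and>
      D2 (z + s *\<^sub>R u + r *\<^sub>R v) v u = D2 (z + s' *\<^sub>R v + r' *\<^sub>R u) u v" for n
  proof -
    obtain s r where 1: "0 < s" "s < t n" "0 < r" "r < t n"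
      "g (z + t n *\<^sub>R u + t n *\<^sub>R v) - g (z + t n *\<^sub>R u) - g (z + t n *\<^sub>R v) + g z
         = (t n)\<^sup>2 * D2 (z + s *\<^sub>R u + r *\<^sub>R v) v u"
      by (rule second_difference_mean_value[OF D D2 t_pos])
    obtain s' r' where 2: "0 < s'" "s' < t n" "0 < r'" "r' < t n"
      "g (z + t n *\<^sub>R v + t n *\<^sub>R u) - g (z + t n *\<^sub>R v) - g (z + t n *\<^sub>R u) + g z
         = (t n)\<^sup>2 * D2 (z + s' *\<^sub>R v + r' *\<^sub>R u) u v"
      by (rule second_difference_mean_value[OF D D2 t_pos])
    have "g (z + t n *\<^sub>R v + t n *\<^sub>R u) = g (z + t n *\<^sub>R u + t n *\<^sub>R v)"
      by (simp add: add_ac)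
    with 1(5) 2(5) have "(t n)\<^sup>2 * D2 (z + s *\<^sub>R u + r *\<^sub>R v) v u
        = (t n)\<^sup>2 * D2 (z + s' *\<^sub>R v + r' *\<^sub>R u) u v"
      by linarith
    then have "D2 (z + s *\<^sub>R u + r *\<^sub>R v) v u = D2 (z + s' *\<^sub>R v + r' *\<^sub>R u) u v"
      using t_pos[of n] by simp
    with 1 2 show ?thesis by blast
  qed
  then obtain s r s' r' where bounds:
      "\<And>n. 0 < s n \<and> s n < t n" "\<And>n. 0 < r n \<and> r n < t n"
      "\<And>n. 0 < s' n \<and> s' n < t n" "\<And>n. 0 < r' n \<and> r' n < t n"
    and eq: "\<And>n. D2 (z + s n *\<^sub>R u + r n *\<^sub>R v) v u = D2 (z + s' n *\<^sub>R v + r' n *\<^sub>R u) u v"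
    by metis
  have squeeze: "a \<longlonglongrightarrow> 0" if "\<And>n. 0 < a n \<and> a n < t n" for a :: "nat \<Rightarrow> real"
    by (rule tendsto_sandwich[OF _ _ tendsto_const t_lim])
       (simp_all add: that less_imp_le)
  have lim: "(\<lambda>n. D2 (z + a n *\<^sub>R c + b n *\<^sub>R d) d c) \<longlonglongrightarrow> D2 z d c"
    if "a \<longlonglongrightarrow> 0" "b \<longlonglongrightarrow> 0" for a b :: "nat \<Rightarrow> real" and c d
  proof -
    have "(\<lambda>n. z + a n *\<^sub>R c + b n *\<^sub>R d) \<longlonglongrightarrow> z + 0 *\<^sub>R c + 0 *\<^sub>R d"
      by (intro tendsto_intros that)
    then have "(\<lambda>n. D2 (z + a n *\<^sub>R c + b n *\<^sub>R d)) \<longlonglongrightarrow> D2 z"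
      using continuous_on_tendsto_compose[OF cont] by fastforce
    then show ?thesis
      by (intro tendsto_intros)
  qed
  have "(\<lambda>n. D2 (z + s n *\<^sub>R u + r n *\<^sub>R v) v u) \<longlonglongrightarrow> D2 z v u"
    by (intro lim squeeze bounds)
  moreover have "(\<lambda>n. D2 (z + s n *\<^sub>R u + r n *\<^sub>R v) v u) \<longlonglongrightarrow> D2 z u v"
    unfolding eq by (intro lim squeeze bounds)
  ultimately show ?thesis
    using LIMSEQ_unique by blast
qed

section \<open>Symmetry of the Hessian blocks\<close>

lemma partial_deriv_has_derivative:
  assumes "(g has_derivative G) (at x)"
  shows "partial_deriv j g x = G (axis j 1)"
proof -
  have "((\<lambda>t::real. g (x + t *\<^sub>R axis j 1)) has_derivative (\<lambda>t. G (t *\<^sub>R axis j 1))) (at 0)"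
    by (rule has_derivative_compose[where g = g]) (auto intro!: derivative_eq_intros assms)
  moreover have "G (t *\<^sub>R axis j 1) = G (axis j 1) * t" for t
    using linear_scale[OF has_derivative_linear[OF assms]] by simp
  ultimately show ?thesis
    unfolding partial_deriv_def has_field_derivative_def[symmetric]
    by (intro DERIV_imp_deriv) (simp add: has_field_derivative_def)
qed

text \<open>
  Both diagonal blocks are the iterated partial derivatives of \<open>g \<circ> \<iota>\<close>, where \<open>\<iota>\<close> is the affine
  embedding \<open>y \<mapsto> (y, p)\<close> or \<open>q \<mapsto> (x, q)\<close> with linear part \<open>L\<close>; the statement for a general \<open>\<iota>\<close>
  covers them at once.
\<close>

lemma iterated_partial_deriv_symmetric:
  fixes \<iota> L :: "real ^ 'n::finite \<Rightarrow> 'a::real_normed_vector"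
  assumes g: "twice_continuously_differentiable g"
    and \<iota>: "\<And>y. (\<iota> has_derivative L) (at y)"
  shows "partial_deriv i (\<lambda>y. partial_deriv j (\<lambda>z. g (\<iota> z)) y) x
       = partial_deriv j (\<lambda>y. partial_deriv i (\<lambda>z. g (\<iota> z)) y) x"
proof -
  obtain D D2 where D: "\<And>z. (g has_derivative blinfun_apply (D z)) (at z)"
    and D2: "\<And>z. (D has_derivative blinfun_apply (D2 z)) (at z)"
    and cont: "continuous_on UNIV D2"
    using g unfolding twice_continuously_differentiable_def by blast
  have first: "partial_deriv k (\<lambda>z. g (\<iota> z)) y = D (\<iota> y) (L (axis k 1))" for k y
    by (rule partial_deriv_has_derivative[OF has_derivative_compose[OF \<iota> D]])
  have second: "partial_deriv k (\<lambda>y. D (\<iota> y) w) x = D2 (\<iota> x) (L (axis k 1)) w" for k w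
    by (rule partial_deriv_has_derivative)
       (rule derivative_eq_intros has_derivative_compose[OF \<iota> D2] refl | simp)+
  show ?thesis
    unfolding first second by (rule second_derivative_symmetric[OF D D2 cont])
qed

lemma
  assumes H: "twice_continuously_differentiable (\<lambda>(y, q). H y q)"
  shows transpose_hess_xx: "transpose (hess_xx H x p) = hess_xx H x p"
    and transpose_hess_pp: "transpose (hess_pp H x p) = hess_pp H x p"
proof -
  have "((\<lambda>y. (y, p)) has_derivative (\<lambda>h. (h, 0))) (at y)" for y
    by (auto intro!: derivative_eq_intros)
  from iterated_partial_deriv_symmetric[OF H this]
  show "transpose (hess_xx H x p) = hess_xx H x p"
    by (simp add: hess_xx_def transpose_def vec_eq_iff)
  have "((\<lambda>q. (x, q)) has_derivative (\<lambda>h. (0, h))) (at q)" for q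
    by (auto intro!: derivative_eq_intros)
  from iterated_partial_deriv_symmetric[OF H this]
  show "transpose (hess_pp H x p) = hess_pp H x p"
    by (simp add: hess_pp_def transpose_def vec_eq_iff)
qed

section \<open>Block computations and preservation of the symplectic form\<close>

lemma sum_UNIV_Plus:
  fixes h :: "'a::finite + 'b::finite \<Rightarrow> 'c::comm_monoid_add"
  shows "sum h UNIV = (\<Sum>i\<in>UNIV. h (Inl i)) + (\<Sum>i\<in>UNIV. h (Inr i))"
  by (simp only: UNIV_Plus_UNIV[symmetric] sum.Plus finite o_def)

lemma block_mat_mult_stack:
  "block_mat A B C D *v stack a b = stack (A *v a + B *v b) (C *v a + D *v b)"
  by (simp add: vec_eq_iff matrix_vector_mult_def block_mat_def stack_def sum_UNIV_Plus
      split: sum.split)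

lemma inner_stack: "stack a b \<bullet> stack c d = a \<bullet> c + b \<bullet> d"
  by (simp add: inner_vec_def stack_def sum_UNIV_Plus)

lemma stack_eq_iff: "stack a b = stack c d \<longleftrightarrow> a = c \<and> b = d"
  by (auto simp: vec_eq_iff stack_def split: sum.splits)

lemma symplectic_form_stack:
  fixes a b c d :: "real ^ 'n::finite"
  shows "symplectic_form (stack a b) (stack c d) = a \<bullet> d - b \<bullet> c"
proof -
  have "(- mat 1 :: real ^ 'n ^ 'n) *v c = - c" for c
    using matrix_vector_mult_diff_rdistrib[of 0 "mat 1" c] by simp
  then show ?thesis
    by (simp add: symplectic_form_def symplectic_J_def block_mat_mult_stack inner_stack)
qed

lemma tangent_solution_iff:
  "tangent_solution H x p dx dl dx' dl' \<longleftrightarrow>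
     dx' = hess_px H x p *v dx + hess_pp H x p *v dl' \<and>
     dl = hess_xx H x p *v dx + transpose (hess_px H x p) *v dl'"
  by (simp add: tangent_solution_def block_mat_mult_stack stack_eq_iff)

theorem mainTheorem3:
  fixes f :: "real ^ 'n::finite \<Rightarrow> real ^ 'm::finite \<Rightarrow> real ^ 'n"
    and l :: "real ^ 'n \<Rightarrow> real ^ 'm \<Rightarrow> real"
    and ustar :: "real ^ 'n \<Rightarrow> real ^ 'n \<Rightarrow> real ^ 'm"
    and H :: "real ^ 'n \<Rightarrow> real ^ 'n \<Rightarrow> real"
    and x p :: "real ^ 'n"
    and dx dl dx' dl' :: "real ^ 'n"
    and ex el ex' el' :: "real ^ 'n"
  assumes "optimal_control f l ustar"
    and "H = optimal_hamiltonian f l ustar"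
    and "twice_continuously_differentiable (\<lambda>(y, q). H y q)"
    and "tangent_solution H x p dx dl dx' dl'"
    and "tangent_solution H x p ex el ex' el'"
  shows "symplectic_form (stack dx dl) (stack ex el) =
         symplectic_form (stack dx' dl') (stack ex' el')"
proof -
  define A B C where "A = hess_px H x p" and "B = hess_pp H x p" and "C = hess_xx H x p"
  have d: "dx' = A *v dx + B *v dl'" "dl = C *v dx + transpose A *v dl'"
    and e: "ex' = A *v ex + B *v el'" "el = C *v ex + transpose A *v el'"
    using assms(4,5) by (simp_all add: tangent_solution_iff A_def B_def C_def)
  have adjoint: "(M *v a) \<bullet> b = a \<bullet> (transpose M *v b)" for M :: "real ^ 'n ^ 'n" and a b
    by (metis dot_lmul_matrix inner_commute transpose_matrix_vector)
  have B: "(B *v a) \<bullet> b = a \<bullet> (B *v b)" for a b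
    using adjoint[of B] transpose_hess_pp[OF assms(3)] by (simp add: B_def)
  have C: "(C *v a) \<bullet> b = a \<bullet> (C *v b)" for a b
    using adjoint[of C] transpose_hess_xx[OF assms(3)] by (simp add: C_def)
  have A: "(A *v a) \<bullet> b = a \<bullet> (transpose A *v b)" "(transpose A *v a) \<bullet> b = a \<bullet> (A *v b)" for a b
    using adjoint[of A] adjoint[of "transpose A"] by simp_all
  show ?thesis
    unfolding symplectic_form_stack d e
    by (simp only: inner_add_left inner_add_right A B C)
qed

end
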